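(* Let $H$ be a fixed graph without isolated vertices. If \[ e(H) > 2v(H) - \alpha(H), \] then \[ \mathrm{TR}(qH) > \mathrm{R}(qH) \] for every sufficiently large integer $q$.
   Context: Graphs are finite, simple, and have at least one vertex. For a graph $G$, $v(G)$ denotes its number of vertices, $e(G)$ its number of edges, and $\alpha(G)$ its independence number. For a positive integer $q$ and a graph $H$, $qH$ denotes the disjoint union of $q$ copies of $H$. For a graph $G$ without isolated vertices, $\mathrm{R}(G)$ denotes the diagonal Ramsey number: the least integer $n$ such that every red--blue colouring of the edges of the complete graph $K_n$ contains a monochromatic copy of $G$ (as a not necessarily induced subgraph). Let $G$ be a graph without isolated vertices and $m = e(G)$. In a red--blue edge-coloured complete graph, a Ramsey chain with target graph $G$ is a sequence $G_1, G_2, \ldots, G_m$ of pairwise edge-disjoint monochromatic subgraphs (each $G_i$ is monochromatic, but different $G_i$ may have different colours) such that $e(G_i) = i$ for all $i$, $G_i$ is isomorphic to a subgraph of $G_{i+1}$ for $1 \leq i < m$, and $G_m \cong G$. The target Ramsey number $\mathrm{TR}(G)$ is the least integer $n$ such that every red--blue colouring of the edges of $K_n$ contains a Ramsey chain with target $G$. It is known (Chartrand and Zhang) that $\mathrm{TR}(G)$ exists for every graph $G$ without isolated vertices. *)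

theory Defs
  imports "HOL-Library.Ramsey"
begin

datatype 'a ugraph = UGraph (verts: "'a set") (edges: "'a set set")

definition simple_graph :: "'a ugraph \<Rightarrow> bool" where
  "simple_graph G \<longleftrightarrow> finite (verts G) \<and> verts G \<noteq> {} \<and> edges G \<subseteq> [verts G]\<^bsup>2\<^esup>"

definition num_verts :: "'a ugraph \<Rightarrow> nat" where
  "num_verts G = card (verts G)"

definition num_edges :: "'a ugraph \<Rightarrow> nat" where
  "num_edges G = card (edges G)"

definition independence_number :: "'a ugraph \<Rightarrow> nat" where
  "independence_number G = Max {card S | S. S \<subseteq> verts G \<and> indep S (edges G)}"

definition no_isolated_verts :: "'a ugraph \<Rightarrow> bool" where
  "no_isolated_verts G \<longleftrightarrow> (\<forall>x\<in>verts G. \<exists>d\<in>edges G. x \<in> d)"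

definition copies :: "nat \<Rightarrow> 'a ugraph \<Rightarrow> ('a \<times> nat) ugraph" where
  "copies q H = UGraph (verts H \<times> {..<q}) {d \<times> {i} | d i. d \<in> edges H \<and> i < q}"

definition subgraph :: "'a ugraph \<Rightarrow> 'a ugraph \<Rightarrow> bool" where
  "subgraph F G \<longleftrightarrow> simple_graph F \<and> verts F \<subseteq> verts G \<and> edges F \<subseteq> edges G"

definition isomorphic :: "'a ugraph \<Rightarrow> 'b ugraph \<Rightarrow> bool" where
  "isomorphic F G \<longleftrightarrow>
    (\<exists>f. bij_betw f (verts F) (verts G) \<and> (\<lambda>d. f ` d) ` edges F = edges G)"

definition complete_graph :: "nat \<Rightarrow> nat ugraph" where
  "complete_graph n = UGraph {..<n} ([{..<n}]\<^bsup>2\<^esup>)"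

datatype colour = Red | Blue

(* A colouring of the edges of complete_graph n is represented by a total function on sets of
   naturals. Its values outside those edges are irrelevant, since it is only evaluated on edges
   of subgraphs of complete_graph n. *)
definition monochromatic :: "(nat set \<Rightarrow> colour) \<Rightarrow> nat ugraph \<Rightarrow> bool" where
  "monochromatic c F \<longleftrightarrow> (\<exists>col. \<forall>d\<in>edges F. c d = col)"

(* LEAST is meaningful by Ramsey's theorem. *)
definition ramsey_number :: "'a ugraph \<Rightarrow> nat" where
  "ramsey_number G = (LEAST n. \<forall>c :: nat set \<Rightarrow> colour.
     \<exists>F. subgraph F (complete_graph n) \<and> monochromatic c F \<and> isomorphic F G)"

(* Only the values of Gs on {1..num_edges G} matter. *)
definition ramsey_chain ::
  "nat \<Rightarrow> (nat set \<Rightarrow> colour) \<Rightarrow> 'a ugraph \<Rightarrow> (nat \<Rightarrow> nat ugraph) \<Rightarrow> bool" where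
  "ramsey_chain n c G Gs \<longleftrightarrow>
     (\<forall>i\<in>{1..num_edges G}.
        subgraph (Gs i) (complete_graph n) \<and> monochromatic c (Gs i) \<and> num_edges (Gs i) = i) \<and>
     (\<forall>i\<in>{1..num_edges G}. \<forall>j\<in>{1..num_edges G}.
        i \<noteq> j \<longrightarrow> edges (Gs i) \<inter> edges (Gs j) = {}) \<and>
     (\<forall>i. 1 \<le> i \<and> i < num_edges G \<longrightarrow>
        (\<exists>F. subgraph F (Gs (i + 1)) \<and> isomorphic (Gs i) F)) \<and>
     isomorphic (Gs (num_edges G)) G"

(* LEAST is meaningful for G without isolated vertices: fix graphs F 1, ..., F m = G with F i a
   subgraph of F (i + 1) with i edges, and look for a monochromatic F i in the i-th of m disjoint
   blocks of vertices, the i-th of size ramsey_number (F i). *)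
definition target_ramsey_number :: "'a ugraph \<Rightarrow> nat" where
  "target_ramsey_number G =
     (LEAST n. \<forall>c :: nat set \<Rightarrow> colour. \<exists>Gs. ramsey_chain n c G Gs)"

lemma simple_graph_copies:
  assumes H: "simple_graph H" and q: "q > 0"
  shows "simple_graph (copies q H)"
proof -
  have "d \<times> {i} \<in> [verts H \<times> {..<q}]\<^bsup>2\<^esup>" if "d \<in> edges H" "i < q" for d i
  proof -
    have "d \<in> [verts H]\<^bsup>2\<^esup>"
      using H that(1) unfolding simple_graph_def by blast
    then have "d \<subseteq> verts H" "finite d" "card d = 2"
      unfolding nsets_def by auto
    moreover have "card (d \<times> {i}) = card d"
      by (simp add: card_cartesian_product)
    ultimately show ?thesis
      using that(2) unfolding nsets_def by auto
  qed
  moreover have "finite (verts H \<times> {..<q})" "verts H \<times> {..<q} \<noteq> {}"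
    using H q unfolding simple_graph_def by auto
  ultimately show ?thesis
    unfolding simple_graph_def copies_def ugraph.sel by blast
qed

lemma no_isolated_verts_copies:
  assumes "no_isolated_verts H"
  shows "no_isolated_verts (copies q H)"
  unfolding no_isolated_verts_def
proof
  fix x assume "x \<in> verts (copies q H)"
  then obtain y i where x: "x = (y, i)" "y \<in> verts H" "i < q"
    unfolding copies_def by auto
  then obtain d where "d \<in> edges H" "y \<in> d"
    using assms unfolding no_isolated_verts_def by blast
  then have "d \<times> {i} \<in> edges (copies q H)" "x \<in> d \<times> {i}"
    using x unfolding copies_def by auto
  then show "\<exists>d\<in>edges (copies q H). x \<in> d"
    by (rule bexI[rotated])
qed

end

(* The graphs of a Ramsey chain with target G have 1 + 2 + ... + m distinct edges, where m = e(G),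
   so m (m + 1) <= n (n - 1) and TR(G) > e(G). It therefore suffices that
   R(qH) <= (2 v(H) - \<alpha>(H)) q + C with C independent of q, which is an upper bound of Burr, Erdos and
   Spencer. If a large red clique and a large blue clique are disjoint, then they contain large
   subsets with all edges between them of one colour, say red; v(H) - \<alpha>(H) vertices of the red
   subset and v(H) of the blue one then carry both a red and a blue copy of H. Remove this "bowtie"
   and use induction on q: whatever colour the remaining q - 1 copies have, one copy of that colour
   can be added. If there is no such pair of cliques, then, after removal of boundedly many
   vertices, one colour has no large clique, and Ramsey's theorem yields disjoint copies of H in the
   other colour greedily, at a cost of only v(H) vertices each. *)

theory Submission
  imports Defs
begin

section \<open>Relabelled graphs\<close>

lemma edge_subset_verts:
  assumes "simple_graph G" "d \<in> edges G"
  shows "d \<subseteq> verts G" "card d = 2"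
  using assms unfolding simple_graph_def nsets_def by auto

lemma edge_cases:
  assumes "simple_graph G" "d \<in> edges G"
  obtains x y where "d = {x, y}" "x \<noteq> y" "x \<in> verts G" "y \<in> verts G"
  using edge_subset_verts[OF assms] by (auto simp: card_2_iff)

lemma finite_edges: "simple_graph G \<Longrightarrow> finite (edges G)"
  unfolding simple_graph_def by (meson finite_imp_finite_nsets finite_subset)

text \<open>For \<open>f\<close> injective on \<open>verts G\<close> this is an isomorphic copy; it
  turns an embedding into a subgraph of \<open>complete_graph n\<close>.\<close>

definition relabel :: "('a \<Rightarrow> 'b) \<Rightarrow> 'a ugraph \<Rightarrow> 'b ugraph" where
  "relabel f G = UGraph (f ` verts G) ((`) f ` edges G)"

lemma relabel_sel [simp]:
  "verts (relabel f G) = f ` verts G" "edges (relabel f G) = (`) f ` edges G"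
  unfolding relabel_def by simp_all

lemma inj_on_image_edges:
  assumes "simple_graph G" "inj_on f (verts G)"
  shows "inj_on ((`) f) (edges G)"
proof (rule inj_onI)
  fix d e assume d: "d \<in> edges G" and e: "e \<in> edges G" and eq: "f ` d = f ` e"
  show "d = e"
    using inj_on_image_eq_iff[OF assms(2) edge_subset_verts(1)[OF assms(1) d]
        edge_subset_verts(1)[OF assms(1) e]] eq by (rule iffD1)
qed

lemma simple_graph_relabel:
  assumes "simple_graph G" "inj_on f (verts G)"
  shows "simple_graph (relabel f G)"
proof -
  have "f ` d \<in> [f ` verts G]\<^bsup>2\<^esup>" if "d \<in> edges G" for d
    using edge_subset_verts[OF assms(1) that] card_image[OF inj_on_subset[OF assms(2)]]
      finite_subset[of d "verts G"] assms(1)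
    unfolding nsets_def simple_graph_def by auto
  then show ?thesis
    using assms(1) unfolding simple_graph_def by auto
qed

text \<open>Go back along \<open>f\<close>, then along \<open>g\<close>. In a chain the same graph
  is placed by two different injections.\<close>

lemma isomorphic_relabels:
  assumes G: "simple_graph G" and f: "inj_on f (verts G)" and g: "inj_on g (verts G)"
  shows "isomorphic (relabel f G) (relabel g G)"
proof -
  let ?h = "\<lambda>x. g (inv_into (verts G) f x)"
  have "bij_betw ?h (f ` verts G) (g ` verts G)"
    using bij_betw_trans[OF bij_betw_inv_into[OF inj_on_imp_bij_betw[OF f]]
        inj_on_imp_bij_betw[OF g]]
    by (simp add: comp_def)
  moreover have "?h ` (f ` d) = g ` d" if "d \<in> edges G" for d
    using edge_subset_verts(1)[OF G that] f by (force simp: image_image intro!: image_cong)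
  ultimately show ?thesis
    unfolding isomorphic_def by (intro exI[of _ ?h]) (auto simp: image_image)
qed

lemma isomorphic_relabel:
  assumes "simple_graph G" "inj_on f (verts G)"
  shows "isomorphic (relabel f G) G"
proof -
  have "relabel id G = G"
    by (cases G) (simp add: relabel_def)
  then show ?thesis
    using isomorphic_relabels[OF assms inj_on_id] by (simp only:)
qed

lemma subgraph_complete_graph:
  assumes "simple_graph F" "verts F \<subseteq> {..<n}"
  shows "subgraph F (complete_graph n)"
  using assms nsets_mono[OF assms(2)]
  unfolding subgraph_def complete_graph_def simple_graph_def by auto

section \<open>Monochromatic embeddings\<close>

text \<open>The target is an arbitrary vertex set rather than a complete graph on an initial
  segment, so that vertices can be deleted during an induction.\<close>

definition embeds :: "(nat set \<Rightarrow> colour) \<Rightarrow> colour \<Rightarrow> 'a ugraph \<Rightarrow> nat set \<Rightarrow> bool" where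
  "embeds c col G V \<longleftrightarrow>
     (\<exists>f. inj_on f (verts G) \<and> f ` verts G \<subseteq> V \<and> (\<forall>d\<in>edges G. c (f ` d) = col))"

lemma embeds_mono: "embeds c col G U \<Longrightarrow> U \<subseteq> V \<Longrightarrow> embeds c col G V"
  unfolding embeds_def by (meson subset_trans)

text \<open>Used to delete exactly v(G) vertices per copy in the greedy argument.\<close>

lemma embeds_card:
  assumes "embeds c col G U"
  obtains W where "W \<subseteq> U" "card W = num_verts G" "embeds c col G W"
proof -
  obtain f where f: "inj_on f (verts G)" "f ` verts G \<subseteq> U" "\<forall>d\<in>edges G. c (f ` d) = col"
    using assms unfolding embeds_def by blast
  show ?thesis
  proof (rule that)
    show "card (f ` verts G) = num_verts G"
      using f(1) unfolding num_verts_def by (rule card_image)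
    show "embeds c col G (f ` verts G)"
      using f unfolding embeds_def by blast
  qed (rule f(2))
qed

lemma embeds_complete_graphD:
  assumes "simple_graph G" "embeds c col G {..<n}"
  shows "\<exists>F. subgraph F (complete_graph n) \<and> monochromatic c F \<and> isomorphic F G"
proof -
  obtain f where f: "inj_on f (verts G)" "f ` verts G \<subseteq> {..<n}" "\<forall>d\<in>edges G. c (f ` d) = col"
    using assms(2) unfolding embeds_def by blast
  have "subgraph (relabel f G) (complete_graph n)"
    using assms(1) f by (intro subgraph_complete_graph simple_graph_relabel) auto
  moreover have "monochromatic c (relabel f G)"
    using f(3) unfolding monochromatic_def by auto
  ultimately show ?thesis
    using isomorphic_relabel[OF assms(1) f(1)] by blast
qed

lemma embeds_copies_0: "embeds c col (copies 0 H) V"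
  unfolding embeds_def copies_def by auto

lemma embeds_copies_Suc:
  assumes H: "simple_graph H"
    and U: "embeds c col H U" and W: "embeds c col (copies q H) W" and disj: "U \<inter> W = {}"
  shows "embeds c col (copies (Suc q) H) (U \<union> W)"
proof -
  obtain f where f: "inj_on f (verts H)" "f ` verts H \<subseteq> U" "\<forall>d\<in>edges H. c (f ` d) = col"
    using U unfolding embeds_def by blast
  obtain g where g: "inj_on g (verts H \<times> {..<q})" "g ` (verts H \<times> {..<q}) \<subseteq> W"
      "\<forall>d\<in>edges (copies q H). c (g ` d) = col"
    using W unfolding embeds_def by (auto simp: copies_def)
  \<comment> \<open>The new copy receives the index \<open>q\<close>; the old ones keep
    theirs.\<close>
  let ?h = "\<lambda>(x, i). if i = q then f x else g (x, i)"
  have hU: "?h (x, q) \<in> U" if "x \<in> verts H" for x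
    using f(2) that by auto
  have hW: "?h (x, i) \<in> W" if "x \<in> verts H" "i < q" for x i
    using g(2) that by auto
  have "inj_on ?h (verts H \<times> {q} \<union> verts H \<times> {..<q})"
    unfolding inj_on_Un
  proof (intro conjI)
    show "inj_on ?h (verts H \<times> {q})"
      using f(1) by (auto simp: inj_on_def)
    show "inj_on ?h (verts H \<times> {..<q})"
      by (subst inj_on_cong[of _ _ g]) (auto intro: g(1))
    have "?h ` (verts H \<times> {q}) \<subseteq> U" "?h ` (verts H \<times> {..<q}) \<subseteq> W"
      using hU hW by blast+
    then show "?h ` (verts H \<times> {q} - verts H \<times> {..<q}) \<inter> ?h ` (verts H \<times> {..<q} - verts H \<times> {q}) = {}"
      using disj by blast
  qed
  moreover have "?h ` (verts H \<times> {q} \<union> verts H \<times> {..<q}) \<subseteq> U \<union> W"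
    using hU hW by blast
  moreover have "verts H \<times> {q} \<union> verts H \<times> {..<q} = verts H \<times> {..<Suc q}"
    by auto
  ultimately have inj: "inj_on ?h (verts H \<times> {..<Suc q})"
    and img: "?h ` (verts H \<times> {..<Suc q}) \<subseteq> U \<union> W"
    by (simp_all only:)
  have col: "c (?h ` (d \<times> {i})) = col" if d: "d \<in> edges H" and i: "i < Suc q" for d i
  proof (cases "i = q")
    case True
    then have "?h ` (d \<times> {i}) = f ` d"
      by force
    then show ?thesis using f(3) d by simp
  next
    case False
    then have "?h ` (d \<times> {i}) = g ` (d \<times> {i})"
      by (intro image_cong) auto
    moreover have "i < q"
      using i False by simp
    then have "d \<times> {i} \<in> edges (copies q H)"
      using d unfolding copies_def ugraph.sel by blast
    ultimately show ?thesis using g(3) by simp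
  qed
  show ?thesis
    unfolding embeds_def copies_def ugraph.sel
  proof (intro exI[of _ ?h] conjI inj img ballI)
    fix e assume "e \<in> {d \<times> {i} | d i. d \<in> edges H \<and> i < Suc q}"
    then obtain d i where e: "e = d \<times> {i}" "d \<in> edges H" "i < Suc q"
      by blast
    show "c (?h ` e) = col"
      unfolding e(1) by (rule col[OF e(2,3)])
  qed
qed

text \<open>Any injection into a monochromatic clique gives every edge the right colour.\<close>

lemma embeds_clique:
  assumes "simple_graph G" "clique W (c -` {col})" "finite W" "num_verts G \<le> card W"
  shows "embeds c col G W"
proof -
  obtain f where f: "f ` verts G \<subseteq> W" "inj_on f (verts G)"
    using assms card_le_inj[of "verts G" W] unfolding num_verts_def simple_graph_def by auto
  have "c (f ` d) = col" if "d \<in> edges G" for d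
    using assms(1) that
  proof (rule edge_cases)
    fix x y assume "d = {x, y}" "x \<noteq> y" "x \<in> verts G" "y \<in> verts G"
    then have "f x \<in> W" "f y \<in> W" "f x \<noteq> f y" "f ` d = {f x, f y}"
      using f inj_onD[OF f(2)] by auto
    then show ?thesis
      using assms(2) unfolding clique_def by simp
  qed
  with f show ?thesis
    unfolding embeds_def by blast
qed

section \<open>Bowties\<close>

lemma independence_number_attained:
  assumes "simple_graph H"
  obtains S where "S \<subseteq> verts H" "indep S (edges H)" "card S = independence_number H"
proof -
  let ?C = "{card S | S. S \<subseteq> verts H \<and> indep S (edges H)}"
  have "?C = card ` {S. S \<subseteq> verts H \<and> indep S (edges H)}"
    by auto
  moreover have "finite {S. S \<subseteq> verts H \<and> indep S (edges H)}"
    using assms unfolding simple_graph_def by (auto intro: finite_subset[of _ "Pow (verts H)"])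
  moreover have "0 \<in> ?C"
    by (intro CollectI exI[of _ "{}"]) (auto simp: indep_def)
  ultimately have "Max ?C \<in> ?C"
    by (intro Max_in) auto
  then show ?thesis
    using that unfolding independence_number_def by auto
qed

lemma independence_number_le_num_verts:
  assumes "simple_graph H"
  shows "independence_number H \<le> num_verts H"
  using independence_number_attained[OF assms] assms
  unfolding num_verts_def simple_graph_def by (metis card_mono)

text \<open>A maximum independent set of \<open>H\<close> goes into \<open>B\<close> and the other
  vertices into \<open>A\<close>. Every edge then has an end in \<open>A\<close>, so the colours
  inside \<open>B\<close> do not matter.\<close>

lemma embeds_bowtie:
  assumes H: "simple_graph H"
    and A: "clique A (c -` {col})" "finite A" "card A = num_verts H - independence_number H"
    and B: "finite B" "card B = num_verts H"
    and disj: "A \<inter> B = {}"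
    and AB: "\<And>a b. a \<in> A \<Longrightarrow> b \<in> B \<Longrightarrow> c {a, b} = col"
  shows "embeds c col H (A \<union> B)"
proof -
  obtain S where S: "S \<subseteq> verts H" "indep S (edges H)" "card S = independence_number H"
    using independence_number_attained[OF H] .
  have fin: "finite (verts H)" "finite S"
    using H S(1) finite_subset unfolding simple_graph_def by auto
  obtain f where f: "f ` (verts H - S) \<subseteq> A" "inj_on f (verts H - S)"
    using card_le_inj[of "verts H - S" A] fin A S card_Diff_subset[of S "verts H"]
    unfolding num_verts_def by auto
  obtain g where g: "g ` S \<subseteq> B" "inj_on g S"
    using card_le_inj[of S B] fin B S card_mono[of "verts H" S]
    unfolding num_verts_def by auto
  let ?h = "\<lambda>x. if x \<in> S then g x else f x"
  have hA: "?h x \<in> A" if "x \<in> verts H" "x \<notin> S" for x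
    using f that by auto
  have hB: "?h x \<in> B" if "x \<in> S" for x
    using g that by auto
  have inj: "inj_on ?h (verts H)"
  proof (rule inj_onI)
    fix x y assume xy: "x \<in> verts H" "y \<in> verts H" "?h x = ?h y"
    then show "x = y"
      using hA[of x] hA[of y] hB[of x] hB[of y] disj inj_onD[OF f(2), of x y] inj_onD[OF g(2), of x y]
      by (cases "x \<in> S"; cases "y \<in> S") auto
  qed
  have "c (?h ` d) = col" if d: "d \<in> edges H" for d
    using H d
  proof (rule edge_cases)
    fix x y assume xy: "d = {x, y}" "x \<noteq> y" "x \<in> verts H" "y \<in> verts H"
    have img: "?h ` d = {?h x, ?h y}"
      unfolding xy(1) by blast
    have ne: "?h x \<noteq> ?h y"
      using inj_onD[OF inj] xy by blast
    have "\<not> (x \<in> S \<and> y \<in> S)"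
      using S(2) d xy unfolding indep_def by blast
    then consider "x \<in> S" "y \<notin> S" | "x \<notin> S" "y \<in> S" | "x \<notin> S" "y \<notin> S"
      by blast
    then show "c (?h ` d) = col"
    proof cases
      case 1
      then show ?thesis using AB[OF hA[of y] hB[of x]] xy img by (simp add: insert_commute)
    next
      case 2
      then show ?thesis using AB[OF hA[of x] hB[of y]] xy img by simp
    next
      case 3
      then have "?h x \<in> A" "?h y \<in> A"
        using hA xy by blast+
      then have "{?h x, ?h y} \<in> c -` {col}"
        using A(1) ne unfolding clique_def by blast
      then show ?thesis using img by simp
    qed
  qed
  moreover have "?h ` verts H \<subseteq> A \<union> B"
    using hA hB by blast
  ultimately show ?thesis
    using inj unfolding embeds_def by blast
qed

text \<open>The copy in colour \<^term>\<open>col'\<close> lies in \<^term>\<open>B\<close>, and the other one reuses vertices of it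
  for an independent set of maximum size.\<close>
lemma bowtie:
  assumes H: "simple_graph H" and cols: "col' \<noteq> col"
    and A: "clique A (c -` {col})" "finite A" "num_verts H \<le> card A"
    and B: "clique B (c -` {col'})" "finite B" "num_verts H \<le> card B"
    and disj: "A \<inter> B = {}"
    and AB: "\<And>a b. a \<in> A \<Longrightarrow> b \<in> B \<Longrightarrow> c {a, b} = col"
  shows "\<exists>U \<subseteq> A \<union> B. card U \<le> 2 * num_verts H - independence_number H \<and>
    (\<forall>col. embeds c col H U)"
proof -
  obtain A0 where A0: "A0 \<subseteq> A" "card A0 = num_verts H - independence_number H"
    using obtain_subset_with_card_n[OF le_trans[OF diff_le_self A(3)]] by metis
  obtain B0 where B0: "B0 \<subseteq> B" "card B0 = num_verts H"
    using B(3) obtain_subset_with_card_n by metis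
  have fin: "finite A0" "finite B0"
    using A0 B0 A B finite_subset by auto
  have "clique A0 (c -` {col})" "clique B0 (c -` {col'})"
    using A B A0 B0 unfolding clique_def by blast+
  moreover have "A0 \<inter> B0 = {}" "\<And>a b. a \<in> A0 \<Longrightarrow> b \<in> B0 \<Longrightarrow> c {a, b} = col"
    using A0 B0 disj AB by blast+
  ultimately have "embeds c col H (A0 \<union> B0)" "embeds c col' H B0"
    using embeds_bowtie[OF H _ fin(1) A0(2) fin(2) B0(2)] embeds_clique[OF H _ fin(2)] B0(2)
    by auto
  then have "embeds c x H (A0 \<union> B0)" for x
    using cols embeds_mono[of c col' H B0 "A0 \<union> B0"] by (cases x; cases col; cases col') auto
  \<comment> \<open>The sizes add up to (v - \<alpha>) + v, which is the truncated 2 v - \<alpha>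
    because \<alpha> \<le> v.\<close>
  moreover have "card (A0 \<union> B0) \<le> 2 * num_verts H - independence_number H"
    using card_Un_le[of A0 B0] A0 B0 independence_number_le_num_verts[OF H] by auto
  ultimately show ?thesis
    using A0 B0 by (intro exI[of _ "A0 \<union> B0"]) auto
qed

text \<open>At most \<open>2 ^ card A\<close> sets occur as red neighbourhoods in \<open>A\<close>,
  so by pigeonhole \<open>k\<close> vertices of \<open>B\<close> share one, say \<open>X\<close>.
  All edges from them to \<open>X\<close> are red and all edges to \<open>A - X\<close> are blue,
  and one of these two sets has at least \<open>k\<close> elements.\<close>

lemma bipartite_ramsey:
  fixes c :: "nat set \<Rightarrow> colour"
  assumes "finite A" "2 * k \<le> card A" "finite B" "k * 2 ^ card A \<le> card B"
  obtains A' B' col where "A' \<subseteq> A" "B' \<subseteq> B" "k \<le> card A'" "k \<le> card B'"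
    "\<And>a b. a \<in> A' \<Longrightarrow> b \<in> B' \<Longrightarrow> c {a, b} = col"
proof -
  let ?N = "\<lambda>b. {a \<in> A. c {a, b} = Red}"
  obtain Y where Y: "Y \<in> Pow A" "card B \<le> card (?N -` {Y} \<inter> B) * card (Pow A)"
    using pigeonhole_card[of ?N B "Pow A"] assms by auto
  have "k * 2 ^ card A \<le> card {b \<in> B. ?N b = Y} * 2 ^ card A"
    using le_trans[OF assms(4) Y(2)] card_Pow[OF assms(1)]
    by (simp add: vimage_def Int_def conj_commute)
  then have "\<exists>X\<in>Pow A. k \<le> card {b \<in> B. ?N b = X}"
    using Y(1) by auto
  then obtain X where X: "X \<subseteq> A" "k \<le> card {b \<in> B. ?N b = X}"
    by blast
  let ?B = "{b \<in> B. ?N b = X}"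
  have "card A = card X + card (A - X)"
    using X assms by (simp add: card_Diff_subset card_mono finite_subset)
  then consider "k \<le> card X" | "k \<le> card (A - X)"
    using assms by linarith
  then show ?thesis
  proof cases
    case 1
    show ?thesis
      by (rule that[of X ?B Red]) (use X 1 in auto)
  next
    case 2
    have "c {a, b} = Blue" if "a \<in> A - X" "b \<in> ?B" for a b
      using that by (cases "c {a, b}") auto
    then show ?thesis
      using that[of "A - X" ?B Blue] X 2 by blast
  qed
qed

section \<open>Ramsey numbers of many copies\<close>

text \<open>Ramsey's theorem for the graph of one colour: with two colours, its independent sets are
  cliques of the other. The bound \<open>r\<close> is uniform in \<open>V\<close>, \<open>c\<close>
  and the choice of colours.\<close>

lemma ramsey_clique:
  "\<exists>r. \<forall>V (c :: nat set \<Rightarrow> colour) col col'. finite V \<and> r \<le> card V \<and> col' \<noteq> col \<longrightarrow>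
     (\<exists>W\<subseteq>V. card W = m \<and> clique W (c -` {col}) \<or> card W = n \<and> clique W (c -` {col'}))"
proof -
  obtain r where r: "\<forall>(V :: nat set) E. finite V \<and> r \<le> card V \<longrightarrow>
      (\<exists>R\<subseteq>V. card R = m \<and> clique R E \<or> card R = n \<and> indep R E)"
    using ramsey2[of m n] by blast
  have "clique W (c -` {col'})" if "indep W (c -` {col})" "col' \<noteq> col"
    for W :: "nat set" and c :: "nat set \<Rightarrow> colour" and col col'
  proof -
    have "- (c -` {col}) = c -` {col'}"
      using that(2) by (auto, metis colour.exhaust)
    then show ?thesis
      using that(1) unfolding clique_def indep_def by blast
  qed
  with r show ?thesis
    by (intro exI[of _ r]) meson
qed

text \<open>Copies are removed one at a time; each uses v(H) vertices, and at least \<open>r\<close>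
  vertices are still there whenever the next one is sought.\<close>

lemma embeds_copies_greedy:
  assumes H: "simple_graph H" and "finite V"
    and "\<And>U. U \<subseteq> V \<Longrightarrow> r \<le> card U \<Longrightarrow> embeds c col H U"
    and "num_verts H * q + r \<le> card V"
  shows "embeds c col (copies q H) V"
  using assms(2-)
proof (induction q arbitrary: V)
  case 0
  show ?case by (rule embeds_copies_0)
next
  case (Suc q)
  have "embeds c col H V"
    using Suc.prems by simp
  then obtain U where U: "U \<subseteq> V" "card U = num_verts H" "embeds c col H U"
    by (rule embeds_card)
  have "card (V - U) = card V - num_verts H"
    using U Suc.prems(1) by (simp add: card_Diff_subset finite_subset)
  then have "embeds c col (copies q H) (V - U)"
    using Suc.prems by (intro Suc.IH) auto
  then have "embeds c col (copies (Suc q) H) (U \<union> (V - U))"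
    by (intro embeds_copies_Suc H U) auto
  then show ?case
    using U(1) by (simp add: Un_absorb1)
qed

text \<open>Induction on \<open>q\<close> with shrinking \<open>V\<close>. Only the bowtie case uses
  the induction hypothesis; in the other cases all copies are found greedily at once.\<close>

lemma embeds_copies_bound:
  assumes H: "simple_graph H"
  shows "\<exists>C. \<forall>q V c. finite V \<and>
     (2 * num_verts H - independence_number H) * q + C \<le> card V \<longrightarrow>
     (\<exists>col. embeds c col (copies q H) V)"
proof -
  define k where "k = num_verts H"
  define t where "t = 2 * k - independence_number H"
  \<comment> \<open>The size that \<open>bipartite_ramsey\<close> asks of the second clique when the
    first has \<open>2 * k\<close> vertices.\<close>
  define s where "s = k * 2 ^ (2 * k)"
  have k: "0 < k"
    using H unfolding k_def num_verts_def simple_graph_def by (simp add: card_gt_0_iff)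
  have kt: "k \<le> t"
    using independence_number_le_num_verts[OF H] unfolding k_def t_def by simp
  obtain r where r: "\<And>V (c :: nat set \<Rightarrow> colour) col col'. finite V \<Longrightarrow> r \<le> card V \<Longrightarrow>
      col' \<noteq> col \<Longrightarrow> \<exists>W\<subseteq>V. card W = k \<and> clique W (c -` {col}) \<or> card W = s \<and> clique W (c -` {col'})"
    using ramsey_clique[of k s] by meson
  \<comment> \<open>In the constant, \<open>r\<close> feeds the greedy argument and
    \<open>2 * k\<close> pays for deleting a red clique.\<close>
  have main: "\<exists>col. embeds c col (copies q H) V" if "finite V" "t * q + (r + 2 * k) \<le> card V"
    for q V c
    using that
  proof (induction q arbitrary: V)
    case 0
    show ?case using embeds_copies_0 by blast
  next
    case (Suc q)
    \<comment> \<open>If \<open>col'\<close> has no clique of size \<open>s\<close> in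
      \<open>V'\<close>, every set of \<open>r\<close> vertices of \<open>V'\<close> contains a
      clique of size \<open>k\<close> in \<open>col\<close>, hence a copy of
      \<open>H\<close>.\<close>
    have greedy: ?case if "col' \<noteq> col" and V': "V' \<subseteq> V" "k * Suc q + r \<le> card V'"
      and no_clique: "\<And>W. W \<subseteq> V' \<Longrightarrow> card W = s \<Longrightarrow> \<not> clique W (c -` {col'})" for V' col col'
    proof -
      have fin: "finite V'"
        using V'(1) Suc.prems(1) by (rule finite_subset)
      have "embeds c col H U" if U: "U \<subseteq> V'" "r \<le> card U" for U
      proof -
        have "finite U"
          using U(1) fin by (rule finite_subset)
        then obtain W where W: "W \<subseteq> U" "card W = k" "clique W (c -` {col})"
          using r[OF _ U(2) \<open>col' \<noteq> col\<close>, of c] no_clique U(1) by (meson subset_trans)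
        then have "embeds c col H W"
          using \<open>finite U\<close> by (intro embeds_clique H) (auto simp: k_def finite_subset)
        then show ?thesis
          using W(1) by (rule embeds_mono)
      qed
      then have "embeds c col (copies (Suc q) H) V'"
        using embeds_copies_greedy[OF H fin] V'(2) unfolding k_def by blast
      then show ?thesis using embeds_mono V'(1) by blast
    qed
    have big: "k * Suc q + r + 2 * k \<le> card V"
      using Suc.prems(2) mult_le_mono1[OF kt, of "Suc q"] by linarith
    show ?case
    proof (cases "\<exists>A\<subseteq>V. card A = 2 * k \<and> clique A (c -` {Red})")
      case False
      have "2 * k \<le> s"
      proof -
        have "(2::nat) ^ 1 \<le> 2 ^ (2 * k)"
          using k by (intro power_increasing) auto
        then show ?thesis unfolding s_def by (simp add: mult.commute)
      qed
      have "\<not> clique W (c -` {Red})" if WV: "W \<subseteq> V" "card W = s" for W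
      proof
        assume W: "clique W (c -` {Red})"
        obtain A where "A \<subseteq> W" "card A = 2 * k"
          using \<open>2 * k \<le> s\<close> WV(2) obtain_subset_with_card_n by metis
        then show False
          using False W WV(1) smaller_clique by (meson subset_trans)
      qed
      then show ?thesis
        using greedy[of Red Blue V] big by auto
    next
      case True
      then obtain A where A: "A \<subseteq> V" "card A = 2 * k" "clique A (c -` {Red})"
        by blast
      then have finA: "finite A"
        using Suc.prems(1) finite_subset by blast
      show ?thesis
      \<comment> \<open>The blue clique is sought outside \<open>A\<close> to make the two cliques
        disjoint; if there is none, red copies are found in \<open>V - A\<close>.\<close>
      proof (cases "\<exists>B\<subseteq>V - A. card B = s \<and> clique B (c -` {Blue})")
        case False
        have "card (V - A) = card V - 2 * k"
          using A finA by (simp add: card_Diff_subset)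
        then show ?thesis
          using greedy[of Blue Red "V - A"] False big by auto
      next
        case True
        then obtain B where B: "B \<subseteq> V - A" "card B = s" "clique B (c -` {Blue})"
          by blast
        then have finB: "finite B"
          using Suc.prems(1) finite_subset by blast
        obtain A' B' col where A'B': "A' \<subseteq> A" "B' \<subseteq> B" "k \<le> card A'" "k \<le> card B'"
            "\<And>a b. a \<in> A' \<Longrightarrow> b \<in> B' \<Longrightarrow> c {a, b} = col"
          using bipartite_ramsey[of A k B c] finA finB A B unfolding s_def by auto
        have fin: "finite A'" "finite B'"
          using A'B'(1,2) finA finB by (auto intro: finite_subset)
        have cl: "clique A' (c -` {Red})" "clique B' (c -` {Blue})"
          using A(3) B(3) A'B'(1,2) unfolding clique_def by blast+
        have disj: "A' \<inter> B' = {}"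
          using A'B'(1,2) B(1) by blast
        \<comment> \<open>The clique whose colour is that of the cross edges plays the part of
          \<open>A\<close> in \<open>bowtie\<close>; hence the swap in the blue case.\<close>
        have "\<exists>U\<subseteq>A' \<union> B'. card U \<le> t \<and> (\<forall>col. embeds c col H U)"
        proof (cases col)
          case Red
          then show ?thesis
            using bowtie[OF H _ cl(1) fin(1) _ cl(2) fin(2) _ disj] A'B'
            unfolding k_def t_def by auto
        next
          case Blue
          have "c {b, a} = Blue" if "a \<in> A'" "b \<in> B'" for a b
            using A'B'(5)[OF that] Blue by (simp add: insert_commute)
          then show ?thesis
            using bowtie[OF H _ cl(2) fin(2) _ cl(1) fin(1) _] disj A'B'
            unfolding k_def t_def by (auto simp: Un_commute Int_commute)
        qed
        then obtain U where U: "U \<subseteq> A' \<union> B'" "card U \<le> t" "\<And>col. embeds c col H U"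
          by blast
        have UV: "U \<subseteq> V"
          using U(1) A'B'(1,2) A(1) B(1) by blast
        have "t * q + (r + 2 * k) \<le> card (V - U)"
          using Suc.prems U(2) UV card_Diff_subset[of U V] finite_subset[of U V] by auto
        \<comment> \<open>The induction hypothesis dictates the colour, and \<open>U\<close>
          supplies one more copy in either colour.\<close>
        then obtain col' where "embeds c col' (copies q H) (V - U)"
          using Suc.IH[of "V - U"] Suc.prems(1) by auto
        then have "embeds c col' (copies (Suc q) H) (U \<union> (V - U))"
          by (intro embeds_copies_Suc H U) auto
        then show ?thesis
          using UV by (auto simp: Un_absorb1)
      qed
    qed
  qed
  then show ?thesis
    unfolding t_def k_def by blast
qed

text \<open>The value q = 0 is excluded because \<open>copies 0 H\<close> has no vertices and so is
  not a \<open>simple_graph\<close>.\<close>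

lemma ramsey_number_copies_le:
  assumes H: "simple_graph H"
  shows "\<exists>C. \<forall>q>0. ramsey_number (copies q H) \<le>
    (2 * num_verts H - independence_number H) * q + C"
proof -
  let ?t = "2 * num_verts H - independence_number H"
  obtain C where C: "\<And>q V c. finite V \<Longrightarrow> ?t * q + C \<le> card V \<Longrightarrow>
      \<exists>col. embeds c col (copies q H) V"
    using embeds_copies_bound[OF H] by blast
  have "ramsey_number (copies q H) \<le> ?t * q + C" if "0 < q" for q
    unfolding ramsey_number_def
  proof (rule Least_le, rule allI)
    fix c :: "nat set \<Rightarrow> colour"
    obtain col where "embeds c col (copies q H) {..<?t * q + C}"
      using C[of "{..<?t * q + C}" q c] by auto
    then show "\<exists>F. subgraph F (complete_graph (?t * q + C)) \<and> monochromatic c F \<and>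
        isomorphic F (copies q H)"
      by (rule embeds_complete_graphD[OF simple_graph_copies[OF H that]])
  qed
  then show ?thesis by blast
qed

section \<open>Target Ramsey numbers\<close>

text \<open>Ensures that the \<open>LEAST\<close> in \<open>target_ramsey_number\<close> is
  attained. By Ramsey's theorem the whole chain can be found inside a single monochromatic
  clique.\<close>

lemma ramsey_chain_exists:
  assumes G: "simple_graph G"
  shows "\<exists>n. \<forall>c. \<exists>Gs. ramsey_chain n c G Gs"
proof -
  define m where "m = num_edges G"
  obtain e where e: "bij_betw e {..<m} (edges G)"
    using ex_bij_betw_nat_finite[OF finite_edges[OF G]]
    unfolding m_def num_edges_def atLeast0LessThan by blast
  \<comment> \<open>The first \<open>i\<close> edges in the enumeration \<open>e\<close>, on all
    vertices of \<open>G\<close>, so that these graphs are nested and end in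
    \<open>G\<close>.\<close>
  define F where "F i = UGraph (verts G) (e ` {..<i})" for i
  have F_sel [simp]: "verts (F i) = verts G" "edges (F i) = e ` {..<i}" for i
    unfolding F_def by auto
  have F_simple: "simple_graph (F i)" if "i \<le> m" for i
  proof -
    have "e ` {..<i} \<subseteq> edges G"
      using e that unfolding bij_betw_def by auto
    then show ?thesis using G unfolding simple_graph_def by auto
  qed
  have F_card: "num_edges (F i) = i" if "i \<le> m" for i
  proof -
    have "inj_on e {..<i}"
      using e that unfolding bij_betw_def by (auto intro: inj_on_subset)
    then show ?thesis by (simp add: num_edges_def card_image)
  qed
  have F_m: "F m = G"
    using e unfolding F_def bij_betw_def by (cases G) auto
  define M where "M = card (verts G \<times> {..m})"
  obtain n where n: "\<And>V (c :: nat set \<Rightarrow> colour). finite V \<Longrightarrow> n \<le> card V \<Longrightarrow>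
      \<exists>W\<subseteq>V. card W = M \<and> clique W (c -` {Red}) \<or> card W = M \<and> clique W (c -` {Blue})"
    using ramsey_clique[of M M] by (metis colour.distinct(1))
  \<comment> \<open>A monochromatic clique has room for disjoint copies of all the \<^term>\<open>F i\<close>.\<close>
  have "\<exists>Gs. ramsey_chain n c G Gs" for c
  proof -
    obtain W col where W: "W \<subseteq> {..<n}" "card W = M" "clique W (c -` {col})"
      using n[of "{..<n}" c] by auto
    have "finite W" "finite (verts G \<times> {..m})"
      using W(1) finite_subset G unfolding simple_graph_def by auto
    then obtain g where g: "g ` (verts G \<times> {..m}) \<subseteq> W" "inj_on g (verts G \<times> {..m})"
      using card_le_inj[of "verts G \<times> {..m}" W] W(2) unfolding M_def by auto
    have inj: "inj_on (\<lambda>x. g (x, i)) (verts G)" if "i \<le> m" for i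
      using that g(2) by (auto simp: inj_on_def)
    \<comment> \<open>The slice with second coordinate \<open>i\<close> is reserved for the
      \<open>i\<close>-th graph, which makes the graphs vertex-disjoint.\<close>
    define Gs where "Gs i = relabel (\<lambda>x. g (x, i)) (F i)" for i
    have simple: "simple_graph (Gs i)" if "i \<le> m" for i
      unfolding Gs_def by (intro simple_graph_relabel F_simple) (auto simp: that inj)
    have vW: "verts (Gs i) \<subseteq> W" if "i \<le> m" for i
      using g(1) that unfolding Gs_def by auto
    have sub: "subgraph (Gs i) (complete_graph n)" if "i \<le> m" for i
      using simple[OF that] vW[OF that] W(1) by (intro subgraph_complete_graph) auto
    have mono: "monochromatic c (Gs i)" if "i \<le> m" for i
    proof -
      have "c d = col" if d: "d \<in> edges (Gs i)" for d
        using simple[OF \<open>i \<le> m\<close>] d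
      proof (rule edge_cases)
        fix x y assume "d = {x, y}" "x \<noteq> y" "x \<in> verts (Gs i)" "y \<in> verts (Gs i)"
        then show ?thesis
          using vW[OF \<open>i \<le> m\<close>] W(3) unfolding clique_def by blast
      qed
      then show ?thesis unfolding monochromatic_def by blast
    qed
    have card: "num_edges (Gs i) = i" if "i \<le> m" for i
    proof -
      have "num_edges (Gs i) = num_edges (F i)"
        using card_image[OF inj_on_image_edges[OF F_simple[OF that], of "\<lambda>x. g (x, i)"]] inj[OF that]
        unfolding num_edges_def Gs_def by simp
      then show ?thesis using F_card[OF that] by simp
    qed
    have disj: "edges (Gs i) \<inter> edges (Gs j) = {}" if "i \<le> m" "j \<le> m" "i \<noteq> j" for i j
    proof -
      have "verts (Gs i) \<inter> verts (Gs j) = {}"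
        using that inj_onD[OF g(2)] unfolding Gs_def by fastforce
      moreover have "d \<noteq> {}" "d \<subseteq> verts (Gs l)" if "d \<in> edges (Gs l)" "l \<le> m" for d l
        using edge_subset_verts[OF simple[OF that(2)] that(1)] by auto
      ultimately show ?thesis using that by blast
    qed
    have chain: "\<exists>F. subgraph F (Gs (i + 1)) \<and> isomorphic (Gs i) F" if "i < m" for i
    proof (intro exI conjI)
      \<comment> \<open>\<open>F i\<close> is placed by the injection of the next slice, and hence
        lies inside \<open>Gs (i + 1)\<close>.\<close>
      let ?F = "relabel (\<lambda>x. g (x, i + 1)) (F i)"
      have "simple_graph ?F"
        using that by (intro simple_graph_relabel F_simple) (auto simp: inj)
      then show "subgraph ?F (Gs (i + 1))"
        unfolding subgraph_def Gs_def by auto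
      show "isomorphic (Gs i) ?F"
        unfolding Gs_def using that by (intro isomorphic_relabels F_simple) (auto simp: inj)
    qed
    have "isomorphic (Gs m) G"
      unfolding Gs_def F_m using isomorphic_relabel[OF G inj] by simp
    then show ?thesis
      using sub mono card disj chain unfolding ramsey_chain_def m_def[symmetric]
      by (intro exI[of _ Gs]) auto
  qed
  then show ?thesis by blast
qed

text \<open>The edge sets are disjoint, so 1 + ... + m is at most the number of edges of the
  complete graph on n vertices; n \<le> m would make that number too small.\<close>

lemma ramsey_chain_num_edges_less:
  assumes chain: "ramsey_chain n c G Gs" and "0 < num_edges G"
  shows "num_edges G < n"
proof -
  define m where "m = num_edges G"
  have sub: "edges (Gs i) \<subseteq> [{..<n}]\<^bsup>2\<^esup>" and card: "card (edges (Gs i)) = i" if "i \<in> {1..m}" for i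
    using chain that
    unfolding ramsey_chain_def subgraph_def complete_graph_def num_edges_def m_def by auto
  have fin: "finite ([{..<n}]\<^bsup>2\<^esup>)"
    by (simp add: finite_imp_finite_nsets)
  have "(\<Sum>i\<in>{1..m}. i) = (\<Sum>i\<in>{1..m}. card (edges (Gs i)))"
    using card by simp
  also have "\<dots> = card (\<Union>i\<in>{1..m}. edges (Gs i))"
    using finite_subset[OF sub fin] chain
    by (intro card_UN_disjoint[symmetric]) (auto simp: ramsey_chain_def m_def)
  also have "\<dots> \<le> card ([{..<n}]\<^bsup>2\<^esup>)"
    using sub by (intro card_mono fin UN_least)
  also have "\<dots> = n * (n - 1) div 2"
    by (simp add: card_nsets choose_two)
  finally have "m * (m + 1) div 2 \<le> n * (n - 1) div 2"
    using gauss_sum_from_Suc_0[of m, where 'a = nat] by simp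
  \<comment> \<open>Parity allows the rounded divisions by 2 to be cleared.\<close>
  moreover have "even (m * (m + 1))" "even (n * (n - 1))"
    by auto
  ultimately have le: "m * (m + 1) \<le> n * (n - 1)"
    by (metis dvd_div_mult_self mult_le_mono1)
  show ?thesis
  proof (rule ccontr)
    assume "\<not> num_edges G < n"
    then have "n \<le> m" unfolding m_def by simp
    then have "n * (n - 1) \<le> m * (m - 1)"
      by (intro mult_le_mono) auto
    also have "\<dots> < m * (m + 1)"
      using assms(2) unfolding m_def by (intro mult_strict_left_mono) auto
    finally show False using le by simp
  qed
qed

lemma num_edges_less_target_ramsey_number:
  assumes "simple_graph G" "0 < num_edges G"
  shows "num_edges G < target_ramsey_number G"
proof -
  have "\<forall>c. \<exists>Gs. ramsey_chain (target_ramsey_number G) c G Gs"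
    unfolding target_ramsey_number_def using ramsey_chain_exists[OF assms(1)] by (rule LeastI_ex)
  then show ?thesis
    using ramsey_chain_num_edges_less assms(2) by blast
qed

text \<open>Edges are nonempty, so \<open>d \<times> {i}\<close> determines both \<open>d\<close>
  and \<open>i\<close>.\<close>

lemma num_edges_copies:
  assumes "simple_graph H"
  shows "num_edges (copies q H) = num_edges H * q"
proof -
  let ?f = "\<lambda>(d, i). d \<times> {i}"
  have "inj_on ?f (edges H \<times> {..<q})"
  proof (rule inj_onI, clarify)
    fix d e and i j :: nat
    assume "d \<in> edges H" "e \<in> edges H" and eq: "d \<times> {i} = e \<times> {j}"
    then have "d \<noteq> {}" "e \<noteq> {}"
      using edge_subset_verts(2)[OF assms] by force+
    with eq show "d = e \<and> i = j"
      by (auto simp: times_eq_iff)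
  qed
  moreover have "edges (copies q H) = ?f ` (edges H \<times> {..<q})"
    unfolding copies_def by auto
  ultimately show ?thesis
    unfolding num_edges_def by (simp add: card_image card_cartesian_product)
qed

theorem theorem9:
  fixes H :: "'a ugraph"
  assumes "simple_graph H"
    and "no_isolated_verts H"
    and "int (num_edges H) > 2 * int (num_verts H) - int (independence_number H)"
  shows "\<exists>q0. \<forall>q\<ge>q0. target_ramsey_number (copies q H) > ramsey_number (copies q H)"
proof -
  let ?t = "2 * num_verts H - independence_number H"
  obtain C where C: "\<And>q. 0 < q \<Longrightarrow> ramsey_number (copies q H) \<le> ?t * q + C"
    using ramsey_number_copies_le[OF assms(1)] by blast
  \<comment> \<open>Strictness in the hypothesis gains at least one edge per copy, which outweighs
    the constant \<open>C\<close> once \<open>q\<close> is large.\<close>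
  have t: "Suc ?t \<le> num_edges H"
    using assms(3) independence_number_le_num_verts[OF assms(1)] by linarith
  \<comment> \<open>Already q \<ge> C absorbs the constant; the extra 1 makes \<open>q\<close>
    positive.\<close>
  have "ramsey_number (copies q H) < target_ramsey_number (copies q H)" if q: "Suc C \<le> q" for q
  proof -
    have "ramsey_number (copies q H) \<le> ?t * q + C"
      using C q by simp
    also have "\<dots> \<le> Suc ?t * q"
      using q by simp
    also have "\<dots> \<le> num_edges H * q"
      using t by (rule mult_le_mono1)
    also have "\<dots> = num_edges (copies q H)"
      by (rule num_edges_copies[OF assms(1), symmetric])
    also have "\<dots> < target_ramsey_number (copies q H)"
      using q t
      by (intro num_edges_less_target_ramsey_number simple_graph_copies assms(1))
        (simp_all add: num_edges_copies[OF assms(1)])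
    finally show ?thesis .
  qed
  then show ?thesis by blast
qed

end
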